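(* Let $0<\mu\le L$ and let $f\in\mathcal{S}^1_{\mu,L}(\mathbb{R}^n)$ with minimizer $x^\star$. If the step size is set to $s=1/(4L)$, then the iterates $\{x_k\}_{k=0}^\infty$ generated by NAG-SC from any initial point $x_0=y_0\in\mathbb{R}^n$, namely $$y_{k+1}=x_k-s\nabla f(x_k),\qquad x_{k+1}=y_{k+1}+\frac{1-\sqrt{\mu s}}{1+\sqrt{\mu s}}\,(y_{k+1}-y_k)\qquad(k\ge 0),$$ satisfy $$f(x_k)-f(x^\star)\le \frac{5L\|x_0-x^\star\|^2}{\left(1+\frac{1}{12}\sqrt{\mu/L}\right)^k}$$ for all $k\ge 0$.
   Context: $\|\cdot\|$ is the Euclidean norm. $\mathcal{S}^1_{\mu,L}(\mathbb{R}^n)$ is the class of differentiable convex functions $f:\mathbb{R}^n\to\mathbb{R}$ whose gradient is $L$-Lipschitz ($\|\nabla f(x)-\nabla f(y)\|\le L\|x-y\|$ for all $x,y$) and which are $\mu$-strongly convex: $f(y)\ge f(x)+\langle\nabla f(x),y-x\rangle+\frac{\mu}{2}\|y-x\|^2$ for all $x,y\in\mathbb{R}^n$. *)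

theory Defs
  imports "HOL-Analysis.Analysis"
begin

definition gradient :: "(real ^ 'n \<Rightarrow> real) \<Rightarrow> real ^ 'n \<Rightarrow> real ^ 'n"
  where "gradient f x = (THE D. GDERIV f x :> D)"

lemma GDERIV_iff_gradient:
  fixes f :: "real ^ 'n \<Rightarrow> real"
  shows "GDERIV f x :> D \<longleftrightarrow> f differentiable (at x) \<and> D = gradient f x"
proof -
  have unique: "D1 = D2" if "GDERIV f x :> D1" "GDERIV f x :> D2" for D1 D2
  proof -
    have "(\<lambda>h. inner h D1) = (\<lambda>h. inner h D2)"
      using that unfolding gderiv_def by (rule has_derivative_unique)
    then have "\<forall>h. inner h D1 = inner h D2" by (simp add: fun_eq_iff)
    then show ?thesis by (simp only: vector_eq_ldot)
  qed
  have gradient_eq: "gradient f x = D" if "GDERIV f x :> D" for D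
    unfolding gradient_def using that by (blast intro: the_equality unique)
  have "GDERIV f x :> gradient f x" if diff: "f differentiable (at x)"
  proof -
    obtain f' where f': "(f has_derivative f') (at x)"
      using diff unfolding differentiable_def by blast
    have "inner h (adjoint f' 1) = f' h" for h
      using adjoint_works[OF has_derivative_linear[OF f'], of h 1] by simp
    then have "GDERIV f x :> adjoint f' 1"
      using f' unfolding gderiv_def by simp
    then show ?thesis using gradient_eq by simp
  qed
  moreover have "f differentiable (at x)" if "GDERIV f x :> D"
    using that unfolding gderiv_def differentiable_def by blast
  ultimately show ?thesis using gradient_eq by blast
qed

definition strongly_convex_smooth :: "real \<Rightarrow> real \<Rightarrow> (real ^ 'n \<Rightarrow> real) set"
  where "strongly_convex_smooth \<mu> L =
    {f. (\<forall>x. f differentiable (at x)) \<and>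
        convex_on UNIV f \<and>
        (\<forall>x y. norm (gradient f x - gradient f y) \<le> L * norm (x - y)) \<and>
        (\<forall>x y. f y \<ge> f x + inner (gradient f x) (y - x) + \<mu> / 2 * (norm (y - x))\<^sup>2)}"

definition nag_sc_iterates ::
    "(real ^ 'n \<Rightarrow> real) \<Rightarrow> real \<Rightarrow> real \<Rightarrow> (nat \<Rightarrow> real ^ 'n) \<Rightarrow> (nat \<Rightarrow> real ^ 'n) \<Rightarrow> bool"
  where "nag_sc_iterates f \<mu> s x y \<longleftrightarrow>
    x 0 = y 0 \<and>
    (\<forall>k. y (Suc k) = x k - s *\<^sub>R gradient f (x k) \<and>
         x (Suc k) = y (Suc k) +
           ((1 - sqrt (\<mu> * s)) / (1 + sqrt (\<mu> * s))) *\<^sub>R (y (Suc k) - y k))"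

end

theory Submission
  imports Defs
begin

text \<open>
  With \<open>r = sqrt (\<mu> s)\<close>, write \<open>x\<^sub>k\<close> as the weighted mean \<open>(y\<^sub>k + r z\<^sub>k) / (1 + r)\<close>. The energy
  \<open>E\<^sub>k = f y\<^sub>k - f x\<^sup>* + \<mu>/2 |z\<^sub>k - x\<^sup>*|\<^sup>2\<close> contracts by \<open>1 - r\<close> in each step. Since \<open>s\<close> is smaller than
  \<open>1/L\<close>, the gradient step decreases \<open>f\<close> by more than this contraction needs, so in fact
  \<open>E\<^sub>k\<^sub>+\<^sub>1 + (3/8) s |\<nabla>f x\<^sub>k|\<^sup>2 \<le> (1 - r) E\<^sub>k\<close>. By convexity \<open>f x\<^sub>k \<le> f y\<^sub>k\<^sub>+\<^sub>1 + s |\<nabla>f x\<^sub>k|\<^sup>2\<close>, hence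
  \<open>f x\<^sub>k - f x\<^sup>* \<le> (8/3) (1 - r) E\<^sub>k\<close> without any loss in the condition number \<open>L/\<mu>\<close>.
\<close>

lemma descent_lemma:
  fixes f :: "'a::real_inner \<Rightarrow> real"
  assumes grad: "\<And>x. GDERIV f x :> g x"
    and lip: "\<And>x y. norm (g x - g y) \<le> L * norm (x - y)"
  shows "f y \<le> f x + inner (g x) (y - x) + L / 2 * (norm (y - x))\<^sup>2"
proof -
  define d where "d = y - x"
  define \<phi> where "\<phi> t = f (x + t *\<^sub>R d) - t * inner (g x) d - L / 2 * t\<^sup>2 * (norm d)\<^sup>2" for t
  have "\<phi> 1 \<le> \<phi> 0"
  proof (rule DERIV_nonpos_imp_nonincreasing[of 0 1 \<phi>])
    fix t :: real
    assume t: "0 \<le> t" "t \<le> 1"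
    have f_line: "((\<lambda>t. f (x + t *\<^sub>R d)) has_real_derivative inner d (g (x + t *\<^sub>R d))) (at t)"
    proof -
      have line: "((\<lambda>t. x + t *\<^sub>R d) has_derivative (\<lambda>h. h *\<^sub>R d)) (at t)"
        by (auto intro!: derivative_eq_intros)
      have "(f has_derivative (\<lambda>h. inner h (g (x + t *\<^sub>R d)))) (at (x + t *\<^sub>R d))"
        using grad[of "x + t *\<^sub>R d"] by (simp add: gderiv_def)
      from has_derivative_compose[OF line this] show ?thesis
        by (simp add: has_field_derivative_def mult_commute_abs)
    qed
    have "(\<phi> has_real_derivative
        inner d (g (x + t *\<^sub>R d)) - inner (g x) d - L * t * (norm d)\<^sup>2) (at t)"
      unfolding \<phi>_def by (rule derivative_eq_intros f_line refl | simp)+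
    moreover have "inner d (g (x + t *\<^sub>R d)) - inner (g x) d \<le> L * t * (norm d)\<^sup>2"
    proof -
      have "inner d (g (x + t *\<^sub>R d)) - inner (g x) d = inner (g (x + t *\<^sub>R d) - g x) d"
        by (simp add: inner_diff_right inner_commute)
      also have "\<dots> \<le> norm (g (x + t *\<^sub>R d) - g x) * norm d"
        by (rule norm_cauchy_schwarz)
      also have "\<dots> \<le> L * norm (t *\<^sub>R d) * norm d"
        using lip[of "x + t *\<^sub>R d" x] by (intro mult_right_mono) auto
      finally show ?thesis
        using t by (simp add: power2_eq_square mult.assoc)
    qed
    ultimately show "\<exists>D. (\<phi> has_real_derivative D) (at t) \<and> D \<le> 0"
      by (intro exI conjI) auto
  qed simp
  then show ?thesis
    by (simp add: \<phi>_def d_def)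
qed

lemma norm_convex_combination_sq_le:
  fixes a b :: "'a::real_inner"
  assumes "0 \<le> r" "r \<le> 1"
  shows "(norm ((1 - r) *\<^sub>R a + r *\<^sub>R b))\<^sup>2 \<le> (1 - r) * (norm a)\<^sup>2 + r * (norm b)\<^sup>2"
proof -
  have "(1 - r) * (norm a)\<^sup>2 + r * (norm b)\<^sup>2 - (norm ((1 - r) *\<^sub>R a + r *\<^sub>R b))\<^sup>2
      = r * (1 - r) * (norm (a - b))\<^sup>2"
    by (simp add: power2_norm_eq_inner inner_simps inner_commute algebra_simps)
  also have "\<dots> \<ge> 0"
    using assms by simp
  finally show ?thesis by simp
qed

text \<open>
  One step of the method, with \<open>x\<^sup>*\<close> at the origin: \<open>X\<close>, \<open>Z\<close> stand for \<open>x\<^sub>k - x\<^sup>*\<close>, \<open>z\<^sub>k - x\<^sup>*\<close>, and \<open>fx\<close>,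
  \<open>fy\<close>, \<open>fy'\<close>, \<open>fs\<close> for the values of \<open>f\<close> at \<open>x\<^sub>k\<close>, \<open>y\<^sub>k\<close>, \<open>y\<^sub>k\<^sub>+\<^sub>1\<close>, \<open>x\<^sup>*\<close>.
\<close>
lemma energy_step:
  fixes X Z g :: "'a::real_inner" and r s \<mu> c fx fy fy' fs :: real
  assumes r: "0 < r" "r \<le> 1" and "0 \<le> \<mu>" and r_sq: "r\<^sup>2 = \<mu> * s"
    and descent: "fy' \<le> fx - c * s * (norm g)\<^sup>2"
    and below_y: "fx + r * inner g (X - Z) \<le> fy"
    and below_min: "fx - inner g X + \<mu> / 2 * (norm X)\<^sup>2 \<le> fs"
  shows "fy' - fs + \<mu> / 2 * (norm ((1 - r) *\<^sub>R Z + r *\<^sub>R X - (s / r) *\<^sub>R g))\<^sup>2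
      + (c - 1 / 2) * s * (norm g)\<^sup>2 \<le> (1 - r) * (fy - fs + \<mu> / 2 * (norm Z)\<^sup>2)"
proof -
  define W where "W = (1 - r) *\<^sub>R Z + r *\<^sub>R X"
  define N where "N = inner g W"
  \<comment> \<open>The step length \<open>s / r\<close> gives the cross term weight
    \<open>r\<close> and the quadratic term weight \<open>s / 2\<close>; the latter is the
    \<open>1 / 2\<close> taken from \<open>c\<close>.\<close>
  have coeffs: "\<mu> * (s / r) = r" "\<mu> * (s / r)\<^sup>2 = s"
    using r r_sq by (auto simp: power2_eq_square field_simps)
  have "(norm (W - (s / r) *\<^sub>R g))\<^sup>2 = (norm W)\<^sup>2 - 2 * (s / r) * N + (s / r)\<^sup>2 * (norm g)\<^sup>2"
    by (simp add: N_def power2_norm_eq_inner inner_diff_left inner_diff_right inner_commute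
        power2_eq_square[of "s / r"] algebra_simps)
  then have "\<mu> / 2 * (norm (W - (s / r) *\<^sub>R g))\<^sup>2
      = \<mu> / 2 * (norm W)\<^sup>2 - (\<mu> * (s / r)) * N + (\<mu> * (s / r)\<^sup>2) / 2 * (norm g)\<^sup>2"
    by (simp only:) (simp add: algebra_simps)
  then have expand: "\<mu> / 2 * (norm (W - (s / r) *\<^sub>R g))\<^sup>2
      = \<mu> / 2 * (norm W)\<^sup>2 - r * N + s / 2 * (norm g)\<^sup>2"
    by (simp only: coeffs)
  have "\<mu> / 2 * (norm W)\<^sup>2 \<le> \<mu> / 2 * ((1 - r) * (norm Z)\<^sup>2 + r * (norm X)\<^sup>2)"
    unfolding W_def using assms by (intro mult_left_mono norm_convex_combination_sq_le) auto
  \<comment> \<open>Weighted by \<open>1 - r\<close> and \<open>r\<close>, the two lower bounds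
    contribute inner products that cancel the cross term \<open>r * N\<close>.\<close>
  moreover have "(1 - r) * (fx + r * inner g (X - Z)) \<le> (1 - r) * fy"
    using below_y r by (intro mult_left_mono) auto
  moreover have "r * (fx - inner g X + \<mu> / 2 * (norm X)\<^sup>2) \<le> r * fs"
    using below_min r by (intro mult_left_mono) auto
  moreover have "r * N = r * ((1 - r) * inner g Z + r * inner g X)"
    by (simp add: N_def W_def inner_simps)
  ultimately show ?thesis
    using descent expand unfolding W_def[symmetric] by (simp add: inner_diff_right algebra_simps diff_divide_distrib)
qed

theorem theorem3:
  fixes f :: "real ^ 'n \<Rightarrow> real"
    and x y :: "nat \<Rightarrow> real ^ 'n"
    and xstar :: "real ^ 'n"
    and \<mu> L s :: real
    and k :: nat
  assumes "0 < \<mu>" and "\<mu> \<le> L"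
    and "f \<in> strongly_convex_smooth \<mu> L"
    and "\<forall>z. f xstar \<le> f z"
    and "s = 1 / (4 * L)"
    and "nag_sc_iterates f \<mu> s x y"
  shows "f (x k) - f xstar \<le> 5 * L * (norm (x 0 - xstar))\<^sup>2 / (1 + sqrt (\<mu> / L) / 12) ^ k"
proof -
  define g where "g = gradient f"
  define r where "r = sqrt (\<mu> * s)"
  define t where "t = sqrt (\<mu> / L)"
  define z where "z k = (1 / r) *\<^sub>R ((1 + r) *\<^sub>R x k - y k)" for k
  define E where "E k = f (y k) - f xstar + \<mu> / 2 * (norm (z k - xstar))\<^sup>2" for k
  define D where "D = (norm (x 0 - xstar))\<^sup>2"
  have L: "0 < L" and s: "0 < s" and Ls: "L * s = 1 / 4"
    using assms by auto
  have t: "0 < t" "t \<le> 1"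
    using assms L by (auto simp: t_def)
  have "\<mu> * s = \<mu> / L / 2\<^sup>2"
    using assms(5) by simp
  then have rt: "r = t / 2"
    unfolding r_def t_def by (simp only: real_sqrt_divide real_sqrt_abs abs_numeral)
  have r: "0 < r" "r \<le> 1"
    using t rt by auto
  have r_sq: "r\<^sup>2 = \<mu> * s"
    using assms(1) s by (simp add: r_def)
  have smooth: "f b \<le> f a + inner (g a) (b - a) + L / 2 * (norm (b - a))\<^sup>2" for a b
    using assms(3)
    by (intro descent_lemma) (auto simp: GDERIV_iff_gradient strongly_convex_smooth_def g_def)
  have strong: "f a + inner (g a) (b - a) + \<mu> / 2 * (norm (b - a))\<^sup>2 \<le> f b" for a b
    using assms(3) by (auto simp: strongly_convex_smooth_def g_def)
  have convex: "f a + inner (g a) (b - a) \<le> f b" for a b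
  proof -
    have "0 \<le> \<mu> / 2 * (norm (b - a))\<^sup>2"
      using assms(1) by simp
    then show ?thesis using strong[of a b] by linarith
  qed
  \<comment> \<open>Here 7/8 is \<open>1 - L * s / 2\<close>; its excess over 1/2 is the 3/8 in
    \<open>step\<close>.\<close>
  have descent: "f (a - s *\<^sub>R g a) \<le> f a - 7 / 8 * s * (norm (g a))\<^sup>2" for a
  proof -
    have "L / 2 * (s * norm (g a))\<^sup>2 = (L * s) * s / 2 * (norm (g a))\<^sup>2"
      by (simp add: power2_eq_square)
    also have "\<dots> = 1 / 8 * s * (norm (g a))\<^sup>2"
      by (simp add: Ls)
    finally show ?thesis
      using smooth[of "a - s *\<^sub>R g a" a] s
      by (simp add: power2_norm_eq_inner[symmetric])
  qed
  \<comment> \<open>A gradient step from the minimizer cannot decrease \<open>f\<close>, so the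
    gradient vanishes there.\<close>
  have "0 \<le> - (7 / 8 * s * (norm (g xstar))\<^sup>2)"
    using descent[of xstar] assms(4)[rule_format, of "xstar - s *\<^sub>R g xstar"] by linarith
  then have g_min: "g xstar = 0"
    using s by (simp add: mult_le_0_iff)
  have x0: "x 0 = y 0" and y_Suc: "y (Suc k) = x k - s *\<^sub>R g (x k)"
    and x_Suc: "x (Suc k) = y (Suc k) + ((1 - r) / (1 + r)) *\<^sub>R (y (Suc k) - y k)" for k
    using assms(6) by (auto simp: nag_sc_iterates_def g_def r_def)
  have y_eq: "y k = (1 + r) *\<^sub>R x k - r *\<^sub>R z k" for k
    using r by (simp add: z_def)
  \<comment> \<open>The momentum coefficient is chosen so that \<open>z\<close> moves by averaging
    with \<open>x k\<close> and a gradient step of length \<open>s / r\<close>, as in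
    \<open>energy_step\<close>.\<close>
  have z_Suc: "z (Suc k) = (1 - r) *\<^sub>R z k + r *\<^sub>R x k - (s / r) *\<^sub>R g (x k)" for k
  proof -
    have "(1 + r) *\<^sub>R x (Suc k) = (1 + r) *\<^sub>R y (Suc k) + (1 - r) *\<^sub>R (y (Suc k) - y k)"
      using r by (simp add: x_Suc scaleR_add_right)
    then have "r *\<^sub>R z (Suc k) = y (Suc k) - (1 - r) *\<^sub>R y k"
      using r by (simp add: z_def algebra_simps)
    also have "\<dots> = x k - s *\<^sub>R g (x k) - (1 - r) *\<^sub>R ((1 + r) *\<^sub>R x k - r *\<^sub>R z k)"
      by (simp only: y_Suc y_eq[symmetric])
    also have "\<dots> = r *\<^sub>R ((1 - r) *\<^sub>R z k + r *\<^sub>R x k - (s / r) *\<^sub>R g (x k))"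
      using r by (simp add: algebra_simps)
    finally show ?thesis using r by simp
  qed
  have step: "E (Suc k) + 3 / 8 * s * (norm (g (x k)))\<^sup>2 \<le> (1 - r) * E k" for k
  proof -
    have "y k - x k = r *\<^sub>R ((x k - xstar) - (z k - xstar))"
      by (simp add: y_eq algebra_simps)
    then have "f (x k) + r * inner (g (x k)) ((x k - xstar) - (z k - xstar)) \<le> f (y k)"
      using convex[of "x k" "y k"] by simp
    moreover have "f (x k) - inner (g (x k)) (x k - xstar) + \<mu> / 2 * (norm (x k - xstar))\<^sup>2 \<le> f xstar"
      using strong[of "x k" xstar] by (simp add: inner_diff_right norm_minus_commute)
    moreover have "z (Suc k) - xstar
        = (1 - r) *\<^sub>R (z k - xstar) + r *\<^sub>R (x k - xstar) - (s / r) *\<^sub>R g (x k)"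
      by (simp add: z_Suc algebra_simps)
    ultimately show ?thesis
      using energy_step[OF r(1,2) less_imp_le[OF assms(1)] r_sq descent[of "x k"]]
      by (simp add: E_def y_Suc)
  qed
  have E_nonneg: "0 \<le> E k" for k
    using assms(1,4) by (simp add: E_def)
  have "E (Suc k) \<le> (1 - r) * E k" for k
  proof -
    have "0 \<le> 3 / 8 * s * (norm (g (x k)))\<^sup>2"
      using s by simp
    then show ?thesis using step[of k] by linarith
  qed
  then have E_decay: "E k \<le> (1 - r) ^ k * E 0" for k
  proof (induction k)
    case (Suc k)
    have "E (Suc k) \<le> (1 - r) * E k" by fact
    also have "\<dots> \<le> (1 - r) * ((1 - r) ^ k * E 0)"
      using Suc r by (intro mult_left_mono) auto
    finally show ?case by simp
  qed simp
  have "z 0 = x 0"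
    using r x0 by (simp add: z_def algebra_simps)
  then have "E 0 \<le> L / 2 * D + \<mu> / 2 * D"
    using smooth[of "x 0" xstar] g_min x0 by (simp add: E_def D_def)
  also have "\<dots> \<le> L * D"
    using assms(2) mult_right_mono[of \<mu> L D] by (simp add: D_def)
  finally have E_0: "E 0 \<le> L * D" .
  have "f (x k) - f xstar \<le> f (y (Suc k)) - f xstar + s * (norm (g (x k)))\<^sup>2"
    using convex[of "x k" "y (Suc k)"] by (simp add: y_Suc power2_norm_eq_inner)
  also have "\<dots> \<le> E (Suc k) + s * (norm (g (x k)))\<^sup>2"
    using assms(1) by (simp add: E_def)
  \<comment> \<open>Multiplying \<open>step\<close> by 8/3 gives the gradient term coefficient
    \<open>s\<close>; the extra \<open>5 / 3 * E (Suc k)\<close> is nonnegative.\<close>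
  also have "\<dots> \<le> 8 / 3 * ((1 - r) * E k)"
    using step[of k] E_nonneg[of "Suc k"] by linarith
  also have "\<dots> \<le> 5 * E k"
    using r E_nonneg[of k] mult_right_mono[of "1 - r" 1 "E k"] by linarith
  also have "\<dots> \<le> 5 * ((1 - r) ^ k * (L * D))"
    using E_decay[of k] mult_left_mono[OF E_0, of "(1 - r) ^ k"] r by simp
  also have "\<dots> \<le> 5 * (1 / (1 + t / 12) ^ k * (L * D))"
  proof -
    \<comment> \<open>The product equals \<open>1 - 5 * t / 12 - t^2 / 24\<close>, so the claimed
      rate is weaker than the factor \<open>1 - r\<close>.\<close>
    have "(1 - r) * (1 + t / 12) \<le> 1"
      using t by (simp add: rt algebra_simps)
    then have "1 - r \<le> 1 / (1 + t / 12)"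
      using t by (simp add: pos_le_divide_eq)
    then have "(1 - r) ^ k \<le> 1 / (1 + t / 12) ^ k"
      using r power_mono[of "1 - r" "1 / (1 + t / 12)" k] by (simp add: power_one_over)
    then show ?thesis
      using L by (intro mult_left_mono mult_right_mono) (auto simp: D_def)
  qed
  finally show ?thesis
    by (simp add: D_def t_def)
qed

end
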